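(* Let $\alpha,\gamma\in\mathbb{C}$ with $\gamma\neq 0,-1,-2,\cdots$, and let ${}_{1}F_{1}(\alpha;\gamma;z)$ be the confluent hypergeometric function. Then, as $r\to\infty$, $T(r,{}_{1}F_{1}(\alpha;\gamma;z))=O(r)$ if $\alpha\notin\mathbb{Z}_{\leq 0}$, and $T(r,{}_{1}F_{1}(\alpha;\gamma;z))=O(\log r)$ if $\alpha\in\mathbb{Z}_{\leq 0}$.
   Context: For $\alpha,\gamma\in\mathbb{C}$ with $\gamma\neq 0,-1,-2,\cdots$, the confluent hypergeometric (Kummer) function is the entire function of $z$ given by ${}_{1}F_{1}(\alpha;\gamma;z):=\sum_{n=0}^{\infty}\frac{(\alpha)_{n}}{n!(\gamma)_{n}}z^{n}$, where $(\alpha)_0=1$ and $(\alpha)_{n}=\alpha(\alpha+1)\cdots(\alpha+n-1)$. $\mathbb{Z}_{\leq 0}=\{0,-1,-2,\cdots\}$. For a meromorphic function $f$ in $\mathbb{C}$, the Nevanlinna characteristic is $T(r,f)=m(r,f)+N(r,f)$, where $m(r,f)=\frac{1}{2\pi}\int_{0}^{2\pi}\log^{+}|f(re^{i\theta})|\,d\theta$, $N(r,f)=\int_{0}^{r}\frac{n(t,f)-n(0,f)}{t}dt+n(0,f)\log r$, $n(t,f)$ is the number of poles of $f$ in $\{|z|\leq t\}$ counted with multiplicity, and $\log^{+}x=\max\{\log x,0\}$ (with $\log^{+}0=0$). For entire $f$, $N(r,f)=0$ and $T(r,f)=m(r,f)$. *)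

theory Defs
  imports
    "HOL-Complex_Analysis.Complex_Analysis"
    "HOL-Library.Landau_Symbols"
begin

text \<open>
  If \<open>\<gamma>\<close> is a non-positive integer, almost all coefficients below are divisions by zero,
  so the definition is only meaningful for \<open>\<gamma> \<notin> \<int>\<^sub>\<le>\<^sub>0\<close>.
\<close>
definition hypergeo_1F1 :: "complex \<Rightarrow> complex \<Rightarrow> complex \<Rightarrow> complex" where
  "hypergeo_1F1 \<alpha> \<gamma> z = (\<Sum>n. pochhammer \<alpha> n / (fact n * pochhammer \<gamma> n) * z ^ n)"

definition log_plus :: "real \<Rightarrow> real" where
  "log_plus x = (if x = 0 then 0 else max (ln x) 0)"

text \<open>
  In the following, a meromorphic function is a total function \<open>f\<close> with
  \<open>f meromorphic_on UNIV\<close>; its values at the poles play no role. Such a function has only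
  finitely many poles in a disc, so the sum in \<open>pole_count\<close> is a finite one; the
  multiplicity of a pole is the negative of its \<open>zorder\<close>.
\<close>
definition pole_count :: "real \<Rightarrow> (complex \<Rightarrow> complex) \<Rightarrow> nat" where
  "pole_count t f = (\<Sum>z | norm z \<le> t \<and> is_pole f z. nat (- zorder f z))"

definition proximity_fun :: "real \<Rightarrow> (complex \<Rightarrow> complex) \<Rightarrow> real" where
  "proximity_fun r f =
     1 / (2 * pi) *
     integral {0..2 * pi} (\<lambda>\<theta>. log_plus (norm (f (of_real r * exp (\<i> * of_real \<theta>)))))"

definition counting_fun :: "real \<Rightarrow> (complex \<Rightarrow> complex) \<Rightarrow> real" where
  "counting_fun r f =
     integral {0..r} (\<lambda>t. (real (pole_count t f) - real (pole_count 0 f)) / t)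
       + real (pole_count 0 f) * ln r"

definition nevanlinna_T :: "real \<Rightarrow> (complex \<Rightarrow> complex) \<Rightarrow> real" where
  "nevanlinna_T r f = proximity_fun r f + counting_fun r f"

end

theory Submission
  imports Defs
begin

text \<open>
  Both estimates are upper bounds, so only the size of \<open>F = \<^sub>1F\<^sub>1(\<alpha>;\<gamma>;\<cdot>)\<close> on a circle matters:
  \<open>F\<close> has no poles, hence \<open>T(r,F) = m(r,F)\<close>, and \<open>|F| \<le> M\<close> on \<open>|z| = r\<close> with \<open>M \<ge> 1\<close> gives
  \<open>0 \<le> m(r,F) \<le> ln M\<close> (lemma \<open>proximity_fun_bounds\<close>).

  To bound \<open>F\<close>, note that \<open>\<gamma>\<close> has positive distance \<open>d\<close> from the closed set of non-positive
  integers. Therefore \<open>|\<alpha> + n| \<le> |\<alpha> - \<gamma>| + |\<gamma> + n| \<le> K |\<gamma> + n|\<close> for \<open>K = 1 + |\<alpha> - \<gamma>| / d\<close> and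
  every \<open>n\<close>, and multiplying these inequalities bounds the quotient of the Pochhammer symbols by
  \<open>K ^ n\<close> (lemma \<open>hypergeo_1F1_coeff_bound\<close>). So the coefficients of \<open>F\<close> are dominated by those
  of \<open>exp (K z)\<close>, and \<open>|F(z)| \<le> exp (K |z|)\<close>: this yields \<open>T(r,F) \<le> K r\<close>.

  If \<open>\<alpha> = -m\<close>, the series stops after the term of order \<open>m\<close>. The same coefficient bound then gives
  \<open>|F(z)| \<le> exp K * r ^ m\<close> for \<open>|z| = r \<ge> 1\<close>, hence \<open>T(r,F) \<le> K + m ln r\<close>.
\<close>

section \<open>Nevanlinna characteristic of a continuous function\<close>

lemma log_plus_nonneg: "log_plus x \<ge> 0"
  by (simp add: log_plus_def)

lemma log_plus_le_ln:
  assumes "0 \<le> x" "x \<le> M" "1 \<le> M"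
  shows "log_plus x \<le> ln M"
  using assms by (auto simp: log_plus_def)

text \<open>
  A mean lies between the bounds of the function. If the integrand is not integrable, its
  integral is by convention \<open>0\<close>, which respects both bounds because \<open>ln M \<ge> 0\<close>.
\<close>
lemma proximity_fun_bounds:
  assumes bound: "\<And>z. norm z = r \<Longrightarrow> norm (f z) \<le> M" and "1 \<le> M" "0 \<le> r"
  shows "0 \<le> proximity_fun r f" "proximity_fun r f \<le> ln M"
proof -
  let ?g = "\<lambda>\<theta>. log_plus (norm (f (of_real r * exp (\<i> * of_real \<theta>))))"
  have g_le: "?g \<theta> \<le> ln M" for \<theta>
    using assms by (intro log_plus_le_ln bound) (auto simp: norm_mult)
  have "0 \<le> integral {0..2*pi} ?g \<and> integral {0..2*pi} ?g \<le> 2 * pi * ln M"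
  proof (cases "?g integrable_on {0..2*pi}")
    case True
    have "integral {0..2*pi} ?g \<le> integral {0..2*pi} (\<lambda>_. ln M)"
      using True g_le by (intro integral_le) auto
    then show ?thesis
      using True by (auto intro!: integral_nonneg log_plus_nonneg)
  next
    case False
    then show ?thesis
      using \<open>1 \<le> M\<close> by (simp add: not_integrable_integral)
  qed
  then show "0 \<le> proximity_fun r f" "proximity_fun r f \<le> ln M"
    by (auto simp: proximity_fun_def field_simps)
qed

lemma not_is_pole_isCont:
  fixes f :: "complex \<Rightarrow> complex"
  assumes "isCont f z"
  shows "\<not> is_pole f z"
  using assms not_tendsto_and_filterlim_at_infinity[of "at z" f "f z"]
  by (auto simp: is_pole_def isCont_def)

lemma nevanlinna_T_eq_proximity_fun:
  assumes "\<And>z. isCont f z"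
  shows "nevanlinna_T r f = proximity_fun r f"
  using not_is_pole_isCont[OF assms]
  by (simp add: nevanlinna_T_def counting_fun_def pole_count_def)

lemma abs_nevanlinna_T_le:
  assumes "\<And>z. isCont f z" "\<And>z. norm z = r \<Longrightarrow> norm (f z) \<le> M" "1 \<le> M" "0 \<le> r"
  shows "\<bar>nevanlinna_T r f\<bar> \<le> ln M"
  using proximity_fun_bounds[of r f M] nevanlinna_T_eq_proximity_fun[of f r] assms by simp

section \<open>Growth of the confluent hypergeometric function\<close>

lemma dist_nonpos_Ints_pos:
  fixes \<gamma> :: complex
  assumes "\<gamma> \<notin> \<int>\<^sub>\<le>\<^sub>0"
  obtains d where "d > 0" "\<And>n. d \<le> norm (\<gamma> + of_nat n)"
proof -
  have "open (- \<int>\<^sub>\<le>\<^sub>0 :: complex set)"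
    by (simp add: open_Compl)
  then obtain d where d: "d > 0" "ball \<gamma> d \<subseteq> - \<int>\<^sub>\<le>\<^sub>0"
    using assms openE by blast
  have "d \<le> norm (\<gamma> + of_nat n)" for n
  proof -
    have "- of_nat n \<notin> ball \<gamma> d"
      using d(2) by auto
    then show ?thesis
      by (simp add: dist_norm)
  qed
  with d(1) show thesis
    by (rule that)
qed

text \<open>
  The comparison with the exponential series: factor by factor, \<open>\<alpha> + n\<close> is at most a fixed
  multiple of \<open>\<gamma> + n\<close>, since both differ by a constant and \<open>\<gamma> + n\<close> stays away from \<open>0\<close>.
\<close>
lemma hypergeo_1F1_coeff_bound:
  fixes \<alpha> \<gamma> :: complex
  assumes "\<gamma> \<notin> \<int>\<^sub>\<le>\<^sub>0"
  obtains K where "K \<ge> 0"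
    "\<And>n. norm (pochhammer \<alpha> n / (fact n * pochhammer \<gamma> n)) \<le> K ^ n / fact n"
proof -
  obtain d where d: "d > 0" "\<And>n. d \<le> norm (\<gamma> + of_nat n)"
    using dist_nonpos_Ints_pos[OF assms] by blast
  define K where "K = 1 + norm (\<alpha> - \<gamma>) / d"
  have "K \<ge> 0"
    using d(1) by (simp add: K_def)
  have factor: "norm (\<alpha> + of_nat n) \<le> K * norm (\<gamma> + of_nat n)" for n
  proof -
    have "norm (\<alpha> + of_nat n) \<le> norm (\<alpha> - \<gamma>) + norm (\<gamma> + of_nat n)"
      using norm_triangle_ineq[of "\<alpha> - \<gamma>" "\<gamma> + of_nat n"] by simp
    also have "norm (\<alpha> - \<gamma>) \<le> norm (\<alpha> - \<gamma>) / d * norm (\<gamma> + of_nat n)"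
      using mult_left_mono[OF d(2)[of n], of "norm (\<alpha> - \<gamma>) / d"] d(1) by simp
    finally show ?thesis
      by (simp add: K_def algebra_simps)
  qed
  have poch: "norm (pochhammer \<alpha> n) \<le> K ^ n * norm (pochhammer \<gamma> n)" for n
  proof (induction n)
    case (Suc n)
    have "norm (pochhammer \<alpha> n) * norm (\<alpha> + of_nat n)
            \<le> (K ^ n * norm (pochhammer \<gamma> n)) * (K * norm (\<gamma> + of_nat n))"
      using Suc factor \<open>K \<ge> 0\<close> by (intro mult_mono) auto
    then show ?case
      by (simp add: pochhammer_Suc norm_mult mult_ac)
  qed simp
  have "norm (pochhammer \<alpha> n / (fact n * pochhammer \<gamma> n)) \<le> K ^ n / fact n" for n
  proof -
    have "pochhammer \<gamma> n \<noteq> 0"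
      using assms by (auto simp: pochhammer_eq_0_iff)
    then show ?thesis
      using poch[of n] by (simp add: norm_divide norm_mult field_simps)
  qed
  with \<open>K \<ge> 0\<close> show thesis
    by (rule that)
qed

lemma powser_dominated_by_exp:
  fixes c :: "nat \<Rightarrow> complex"
  assumes "\<And>n. norm (c n) \<le> K ^ n / fact n"
  shows "summable (\<lambda>n. c n * z ^ n)" "norm (\<Sum>n. c n * z ^ n) \<le> exp (K * norm z)"
proof -
  have term_le: "norm (c n * z ^ n) \<le> (K * norm z) ^ n / fact n" for n
    using mult_right_mono[OF assms[of n], of "norm z ^ n"]
    by (simp add: norm_mult norm_power power_mult_distrib)
  have exp_series: "(\<lambda>n. (K * norm z) ^ n / fact n) sums exp (K * norm z)"
    using exp_converges[of "K * norm z"] by (simp add: field_simps)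
  show "summable (\<lambda>n. c n * z ^ n)"
    by (rule summable_comparison_test'[OF sums_summable[OF exp_series]]) (rule term_le)
  show "norm (\<Sum>n. c n * z ^ n) \<le> exp (K * norm z)"
    using norm_suminf_le[OF term_le sums_summable[OF exp_series]] sums_unique[OF exp_series] by simp
qed

text \<open>
  On \<open>|z| \<ge> 1\<close> every power up to the degree is at most \<open>|z| ^ m\<close>, so the sum of the absolute
  coefficients, itself below \<open>exp K\<close>, can be pulled out.
\<close>
lemma poly_dominated_by_exp:
  fixes c :: "nat \<Rightarrow> complex"
  assumes c: "\<And>n. norm (c n) \<le> K ^ n / fact n" and "K \<ge> 0"
    and zero: "\<And>n. n > m \<Longrightarrow> c n = 0" and "norm z \<ge> 1"
  shows "norm (\<Sum>n. c n * z ^ n) \<le> exp K * norm z ^ m"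
proof -
  have "(\<Sum>n. c n * z ^ n) = (\<Sum>n\<le>m. c n * z ^ n)"
    using zero by (intro suminf_finite) auto
  also have "norm \<dots> \<le> (\<Sum>n\<le>m. K ^ n / fact n * norm z ^ m)"
  proof (rule sum_norm_le)
    fix n assume "n \<in> {..m}"
    then show "norm (c n * z ^ n) \<le> K ^ n / fact n * norm z ^ m"
      using assms unfolding norm_mult norm_power
      by (intro mult_mono power_increasing) auto
  qed
  also have "\<dots> = (\<Sum>n\<le>m. K ^ n / fact n) * norm z ^ m"
    by (simp add: sum_distrib_right)
  also have "(\<Sum>n\<le>m. K ^ n / fact n) \<le> exp K"
  proof -
    have exp_series: "(\<lambda>n. K ^ n / fact n) sums exp K"
      using exp_converges[of K] by (simp add: field_simps)
    show ?thesis
      using sum_le_suminf[OF sums_summable[OF exp_series], of "{..m}"] \<open>K \<ge> 0\<close>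
        sums_unique[OF exp_series] by simp
  qed
  finally show ?thesis
    by (simp add: mult_right_mono)
qed

section \<open>The two growth estimates\<close>

theorem theorem3p1:
  fixes \<alpha> \<gamma> :: complex
  assumes "\<gamma> \<notin> \<int>\<^sub>\<le>\<^sub>0"
  shows "(\<alpha> \<notin> \<int>\<^sub>\<le>\<^sub>0 \<longrightarrow>
            (\<lambda>r::real. nevanlinna_T r (hypergeo_1F1 \<alpha> \<gamma>)) \<in> O[at_top](\<lambda>r. r)) \<and>
         (\<alpha> \<in> \<int>\<^sub>\<le>\<^sub>0 \<longrightarrow>
            (\<lambda>r::real. nevanlinna_T r (hypergeo_1F1 \<alpha> \<gamma>)) \<in> O[at_top](\<lambda>r. ln r))"
proof -
  define c where "c = (\<lambda>n. pochhammer \<alpha> n / (fact n * pochhammer \<gamma> n))"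
  let ?F = "hypergeo_1F1 \<alpha> \<gamma>"
  have F: "?F = (\<lambda>z. \<Sum>n. c n * z ^ n)"
    by (simp add: hypergeo_1F1_def c_def fun_eq_iff)
  obtain K where K: "K \<ge> 0" and c_le: "\<And>n. norm (c n) \<le> K ^ n / fact n"
    unfolding c_def by (rule hypergeo_1F1_coeff_bound[OF assms, of \<alpha>]) blast
  have cont: "isCont ?F z" for z
    unfolding F
    by (rule isCont_powser_converges_everywhere) (rule powser_dominated_by_exp(1)[OF c_le])
  have linear: "(\<lambda>r. nevanlinna_T r ?F) \<in> O[at_top](\<lambda>r. r)"
  proof (rule bigoI)
    show "\<forall>\<^sub>F r in at_top. norm (nevanlinna_T r ?F) \<le> K * norm r"
      using eventually_ge_at_top[of 0]
    proof eventually_elim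
      case (elim r)
      have "norm (?F z) \<le> exp (K * r)" if "norm z = r" for z
        using powser_dominated_by_exp(2)[OF c_le, of z] that by (simp add: F)
      then show ?case
        using abs_nevanlinna_T_le[of ?F r "exp (K * r)", OF cont] K elim by simp
    qed
  qed
  have logarithmic: "(\<lambda>r. nevanlinna_T r ?F) \<in> O[at_top](\<lambda>r. ln r)" if "\<alpha> \<in> \<int>\<^sub>\<le>\<^sub>0"
  proof -
    obtain m where m: "\<alpha> = - of_nat m"
      using \<open>\<alpha> \<in> \<int>\<^sub>\<le>\<^sub>0\<close> by (elim nonpos_Ints_cases')
    have zero: "c n = 0" if "n > m" for n
      using that by (simp add: c_def m pochhammer_of_nat_eq_0_iff)
    show ?thesis
    proof (rule bigoI)
      \<comment> \<open>For \<open>r \<ge> exp 1\<close> the constant \<open>K\<close> is at most \<open>K * ln r\<close>.\<close>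
      show "\<forall>\<^sub>F r in at_top. norm (nevanlinna_T r ?F) \<le> (K + real m) * norm (ln r)"
        using eventually_ge_at_top[of "exp 1"]
      proof eventually_elim
        case (elim r)
        have r: "r \<ge> 1" "ln r \<ge> 1"
          using elim one_le_exp_iff[of 1] ln_mono[of "exp 1" r] by (auto simp del: one_le_exp_iff)
        have "norm (?F z) \<le> exp K * r ^ m" if "norm z = r" for z
          using poly_dominated_by_exp[where z = z, OF c_le K zero] that r by (simp add: F)
        moreover have "exp K * r ^ m \<ge> 1"
          using mult_mono[of 1 "exp K" 1 "r ^ m"] K r by simp
        ultimately have "\<bar>nevanlinna_T r ?F\<bar> \<le> ln (exp K * r ^ m)"
          using r by (intro abs_nevanlinna_T_le cont) auto
        also have "\<dots> = K + real m * ln r"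
          using r by (simp add: ln_mult ln_realpow)
        also have "\<dots> \<le> (K + real m) * ln r"
          using mult_left_mono[OF r(2) K] by (simp add: algebra_simps)
        finally show ?case
          using r by simp
      qed
    qed
  qed
  from linear logarithmic show ?thesis
    by blast
qed

end
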